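(* Let $Z=(X,Y)$ be the planar piecewise smooth vector field on $\mathbb{R}^2$ given by $X(x,y)=(1,-2x)$ for $y\ge 0$ and $Y(x,y)=(-2,-4x^{3}+2x)$ for $y\le 0$, with switching manifold $\Sigma=f^{-1}(0)=\{(x,y)\in\mathbb{R}^{2}: y=0\}$, $f(x,y)=y$. Then $Z$ is chaotic on the compact invariant set $$\Lambda=\{(x,y)\in\mathbb{R}^{2}: -1\leq x\leq 1 \text{ and } x^{4}/2-x^{2}/2\leq y\leq 1-x^{2}\}.$$
   Context: **Piecewise smooth vector fields (PSVFs).** Let $V\subset\mathbb{R}^2$ be a neighborhood of $0$ (here $V=\mathbb{R}^2$), $f:V\to\mathbb{R}$ smooth with $0$ a regular value, $\Sigma=f^{-1}(0)$ (the switching manifold), $\Sigma^+=\{q\in V: f(q)\ge 0\}$, $\Sigma^-=\{q\in V: f(q)\le 0\}$. A PSVF $Z=(X,Y)$ equals $X$ on $\Sigma^+$ and $Y$ on $\Sigma^-$, where $X,Y$ are $C^r$ vector fields on $V$ ($r\ge1$ large enough); it is allowed to be multivalued on $\Sigma$. The set of PSVFs is $\Omega$. Write $X.f(p)=\langle\nabla f(p),X(p)\rangle$, and similarly $Y.f$. On $\Sigma$ one distinguishes the sewing region $\Sigma^c$: $(X.f)(Y.f)>0$; the escaping region $\Sigma^e$: $X.f>0$, $Y.f<0$; the sliding region $\Sigma^s$: $X.f<0$, $Y.f>0$. On $\Sigma^s$ the sliding vector field is $Z^s(q)=m-q$, where $m$ is the point of the segment joining $q+X(q)$ and $q+Y(q)$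 such that $m-q$ is tangent to $\Sigma$; on $\Sigma^e$ the escaping vector field is $Z^e=-(-Z)^s$. Both are denoted $Z^\Sigma$. A tangency point is $q\in\Sigma$ with $(X.f(q))(Y.f(q))=0$. A tangency of $X$ (resp. $Y$) at $q$ is visible if there is an orbit of $X$ in $\Sigma^+$ (resp. of $Y$ in $\Sigma^-$) reaching $q$ in finite time, and invisible otherwise. A tangency point is singular if it is an invisible tangency for both $X$ and $Y$, and regular otherwise. **Local trajectories** $\phi_Z(t,p)$, $t$ in an interval $I\ni 0$ (arcs of $X$ lie in $\Sigma^+$, arcs of $Y$ lie in $\Sigma^-$, arcs of $Z^\Sigma$ lie in $\Sigma^e\cup\Sigma^s$ and its limit tangency points, where $Z^\Sigma$ is extended by continuity): - $p\in\Sigma^+\setminus\Sigma$: $\phi_Z=\phi_X$; $p\in\Sigma^-\setminus\Sigma$: $\phi_Z=\phi_Y$. - $p\in\Sigma^c$ with $X.f(p),Y.f(p)>0$: $\phi_Z=\phi_Y$ for $t\le0$ and $\phi_Z=\phi_X$ for $t\ge0$; if $X.f(p),Y.f(p)<0$, the same reversing time. - $p\in\Sigma^e$: $\phi_Z=\phi_{Z^\Sigma}$ for $t\le 0$, and for $t\ge0$ $\phi_Z$ is any one of $\phi_X$, $\phi_Y$, $\phi_{Z^\Sigma}$; for $p\in\Sigma^s$, the same reversing time. - $p$ a regular tangency point: $\phi_Z=\phi_1$ for $t\le0$ and $\phi_Z=\phi_2$ for $t\ge0$, where each of $\phi_1,\phi_2$ is one of $\phi_X,\phi_Y,\phi_{Z^\Sigma}$.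 - $p$ a singular tangency point: $\phi_Z(t,p)=p$ for all $t\in\mathbb{R}$. **Global trajectories.** A global trajectory $\Gamma_Z(t,p_0)$ of $Z$ through $p_0$ is a union $\bigcup_{i\in\mathbb{Z}}\{\sigma_i(t,p_i): t_i\le t\le t_{i+1}\}$ of orientation-preserving local trajectories $\sigma_i$ with $\sigma_i(t_{i+1},p_i)=\sigma_{i+1}(t_{i+1},p_{i+1})=p_{i+1}$ and $t_i\to\pm\infty$ as $i\to\pm\infty$. It is a positive (resp. negative) global trajectory if $i\in\mathbb{N}$ (resp. $-i\in\mathbb{N}$) and $t_0=0$. Global trajectories through a given point need not be unique. **Invariance.** A set $A\subset\mathbb{R}^2$ is ($Z$-)invariant if for each $p\in A$ every global trajectory through $p$ is contained in $A$. **Chaos.** $Z$ is topologically transitive on an invariant set $W$ if for every pair of nonempty open sets $U_1,U_2$ in $W$ there exist $q\in U_1$, a positive global trajectory $\Gamma_Z^+(t,q)$ and $t_0>0$ with $\Gamma_Z^+(t_0,q)\in U_2$. $Z$ exhibits sensitive dependence on a compact invariant set $W$ if there is a fixed $r>0$, $r<\mathrm{diam}(W)$, such that for each $x\in W$ and $\varepsilon>0$ there exist $y\in B_\varepsilon(x)\cap W$ and positive global trajectories $\Gamma_x^+$, $\Gamma_y^+$ through $x$ and $y$ respectively with $d_H(\Gamma_x^+,\Gamma_y^+)=\sup_{a\in\Gamma_x^+,\,b\in\Gamma_y^+}d(a,b)>r$, where $d$ is the Euclidean distance. $Z$ is chaotic on a compact invariant set $W$ if it is topologically transitive and exhibits sensitive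 dependence on $W$. *)

theory Defs
  imports "HOL-Analysis.Analysis"
begin

definition grad :: "(real \<times> real \<Rightarrow> real) \<Rightarrow> real \<times> real \<Rightarrow> real \<times> real" where
  "grad f p = (THE D. GDERIV f p :> D)"

definition lie_deriv ::
    "(real \<times> real \<Rightarrow> real \<times> real) \<Rightarrow> (real \<times> real \<Rightarrow> real) \<Rightarrow> real \<times> real \<Rightarrow> real" where
  "lie_deriv X f p = grad f p \<bullet> X p"

(* Meant for q with (X.f)(q) (Y.f)(q) < 0, where the point m exists and is unique;
   m - q is tangent to the level set of f through q iff it is orthogonal to grad f q. *)
definition filippov_field ::
    "(real \<times> real \<Rightarrow> real) \<Rightarrow> (real \<times> real \<Rightarrow> real \<times> real) \<Rightarrow> (real \<times> real \<Rightarrow> real \<times> real)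
      \<Rightarrow> real \<times> real \<Rightarrow> real \<times> real" where
  "filippov_field f X Y q =
     (THE m. m \<in> closed_segment (q + X q) (q + Y q) \<and> grad f q \<bullet> (m - q) = 0) - q"

(* \<phi> solves \<phi>' = F \<circ> \<phi> on the interval J (one-sided derivatives at endpoints belonging to J)
   and stays in S. For J = {0} this only says \<phi> 0 \<in> S. *)
definition arc_in ::
    "(real \<times> real \<Rightarrow> real \<times> real) \<Rightarrow> (real \<times> real) set \<Rightarrow> real set \<Rightarrow> (real \<Rightarrow> real \<times> real) \<Rightarrow> bool" where
  "arc_in F S J \<phi> \<longleftrightarrow>
     (\<forall>t\<in>J. (\<phi> has_vector_derivative F (\<phi> t)) (at t within J) \<and> \<phi> t \<in> S)"

(* The supremum (not the Hausdorff distance) of all distances between points of A and B;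
   taken in ereal because a positive trajectory may be unbounded. *)
definition sup_distance :: "(real \<times> real) set \<Rightarrow> (real \<times> real) set \<Rightarrow> ereal" where
  "sup_distance A B = (SUP (a, b) \<in> A \<times> B. ereal (dist a b))"

(* The planar piecewise smooth vector field Z = (X, Y) with switching manifold f = 0. *)
locale psvf =
  fixes f :: "real \<times> real \<Rightarrow> real"
    and X Y :: "real \<times> real \<Rightarrow> real \<times> real"
begin

definition switching :: "(real \<times> real) set" where
  "switching = {q. f q = 0}"

definition upper :: "(real \<times> real) set" where
  "upper = {q. f q \<ge> 0}"

definition lower :: "(real \<times> real) set" where
  "lower = {q. f q \<le> 0}"

definition escaping :: "(real \<times> real) set" where
  "escaping = {q \<in> switching. lie_deriv X f q > 0 \<and> lie_deriv Y f q < 0}"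

definition sliding :: "(real \<times> real) set" where
  "sliding = {q \<in> switching. lie_deriv X f q < 0 \<and> lie_deriv Y f q > 0}"

definition tangency :: "(real \<times> real) set" where
  "tangency = {q \<in> switching. lie_deriv X f q * lie_deriv Y f q = 0}"

(* The condition \<phi> 0 \<noteq> q excludes the constant orbit at an equilibrium q. *)
definition visible_X :: "real \<times> real \<Rightarrow> bool" where
  "visible_X q \<longleftrightarrow> q \<in> switching \<and> lie_deriv X f q = 0 \<and>
     (\<exists>\<phi> T. T > 0 \<and> arc_in X upper {0..T} \<phi> \<and> \<phi> 0 \<noteq> q \<and> \<phi> T = q)"

definition visible_Y :: "real \<times> real \<Rightarrow> bool" where
  "visible_Y q \<longleftrightarrow> q \<in> switching \<and> lie_deriv Y f q = 0 \<and>
     (\<exists>\<phi> T. T > 0 \<and> arc_in Y lower {0..T} \<phi> \<and> \<phi> 0 \<noteq> q \<and> \<phi> T = q)"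

definition invisible_X :: "real \<times> real \<Rightarrow> bool" where
  "invisible_X q \<longleftrightarrow> q \<in> switching \<and> lie_deriv X f q = 0 \<and> \<not> visible_X q"

definition invisible_Y :: "real \<times> real \<Rightarrow> bool" where
  "invisible_Y q \<longleftrightarrow> q \<in> switching \<and> lie_deriv Y f q = 0 \<and> \<not> visible_Y q"

definition singular_tangency :: "(real \<times> real) set" where
  "singular_tangency = {q \<in> tangency. invisible_X q \<and> invisible_Y q}"

definition regular_tangency :: "(real \<times> real) set" where
  "regular_tangency = tangency - singular_tangency"

definition sigma_field0 :: "real \<times> real \<Rightarrow> real \<times> real" where
  "sigma_field0 q =
     (if q \<in> escaping then - filippov_field f (\<lambda>p. - X p) (\<lambda>p. - Y p) q
      else filippov_field f X Y q)"

definition limit_tangency :: "(real \<times> real) set" where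
  "limit_tangency = {q \<in> tangency. q islimpt (escaping \<union> sliding) \<and>
     (\<exists>l. (sigma_field0 \<longlongrightarrow> l) (at q within (escaping \<union> sliding)))}"

definition sigma_domain :: "(real \<times> real) set" where
  "sigma_domain = escaping \<union> sliding \<union> limit_tangency"

(* Extension by continuity to the limit tangency points; only meant on sigma_domain. *)
definition sigma_field :: "real \<times> real \<Rightarrow> real \<times> real" where
  "sigma_field q =
     (if q \<in> escaping \<union> sliding then sigma_field0 q
      else Lim (at q within (escaping \<union> sliding)) sigma_field0)"

definition arc_X :: "real set \<Rightarrow> (real \<Rightarrow> real \<times> real) \<Rightarrow> bool" where
  "arc_X J \<phi> \<longleftrightarrow> arc_in X upper J \<phi>"

definition arc_Y :: "real set \<Rightarrow> (real \<Rightarrow> real \<times> real) \<Rightarrow> bool" where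
  "arc_Y J \<phi> \<longleftrightarrow> arc_in Y lower J \<phi>"

definition arc_Sigma :: "real set \<Rightarrow> (real \<Rightarrow> real \<times> real) \<Rightarrow> bool" where
  "arc_Sigma J \<phi> \<longleftrightarrow> arc_in sigma_field sigma_domain J \<phi>"

definition some_arc :: "real set \<Rightarrow> (real \<Rightarrow> real \<times> real) \<Rightarrow> bool" where
  "some_arc J \<phi> \<longleftrightarrow> arc_X J \<phi> \<or> arc_Y J \<phi> \<or> arc_Sigma J \<phi>"

inductive local_trajectory ::
    "real \<times> real \<Rightarrow> real set \<Rightarrow> (real \<Rightarrow> real \<times> real) \<Rightarrow> bool"
  for p :: "real \<times> real" and I :: "real set" and \<phi> :: "real \<Rightarrow> real \<times> real"
where
  above: "\<lbrakk>is_interval I; 0 \<in> I; \<phi> 0 = p; p \<in> upper - switching; arc_X I \<phi>\<rbrakk>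
    \<Longrightarrow> local_trajectory p I \<phi>"
| below: "\<lbrakk>is_interval I; 0 \<in> I; \<phi> 0 = p; p \<in> lower - switching; arc_Y I \<phi>\<rbrakk>
    \<Longrightarrow> local_trajectory p I \<phi>"
| sewing_up: "\<lbrakk>is_interval I; 0 \<in> I; \<phi> 0 = p; p \<in> switching;
      lie_deriv X f p > 0; lie_deriv Y f p > 0;
      arc_Y (I \<inter> {..0}) \<phi>; arc_X (I \<inter> {0..}) \<phi>\<rbrakk>
    \<Longrightarrow> local_trajectory p I \<phi>"
| sewing_down: "\<lbrakk>is_interval I; 0 \<in> I; \<phi> 0 = p; p \<in> switching;
      lie_deriv X f p < 0; lie_deriv Y f p < 0;
      arc_X (I \<inter> {..0}) \<phi>; arc_Y (I \<inter> {0..}) \<phi>\<rbrakk>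
    \<Longrightarrow> local_trajectory p I \<phi>"
| escape: "\<lbrakk>is_interval I; 0 \<in> I; \<phi> 0 = p; p \<in> escaping;
      arc_Sigma (I \<inter> {..0}) \<phi>; some_arc (I \<inter> {0..}) \<phi>\<rbrakk>
    \<Longrightarrow> local_trajectory p I \<phi>"
| slide: "\<lbrakk>is_interval I; 0 \<in> I; \<phi> 0 = p; p \<in> sliding;
      some_arc (I \<inter> {..0}) \<phi>; arc_Sigma (I \<inter> {0..}) \<phi>\<rbrakk>
    \<Longrightarrow> local_trajectory p I \<phi>"
| regular: "\<lbrakk>is_interval I; 0 \<in> I; \<phi> 0 = p; p \<in> regular_tangency;
      some_arc (I \<inter> {..0}) \<phi>; some_arc (I \<inter> {0..}) \<phi>\<rbrakk>
    \<Longrightarrow> local_trajectory p I \<phi>"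
| singular: "\<lbrakk>is_interval I; 0 \<in> I; p \<in> singular_tangency; \<forall>t\<in>I. \<phi> t = p\<rbrakk>
    \<Longrightarrow> local_trajectory p I \<phi>"

(* On [a, b], \<Gamma> runs along a local trajectory based at \<Gamma> a, whose own time is shifted
   so that it starts at 0. *)
definition trajectory_piece :: "(real \<Rightarrow> real \<times> real) \<Rightarrow> real \<Rightarrow> real \<Rightarrow> bool" where
  "trajectory_piece \<Gamma> a b \<longleftrightarrow>
     (\<exists>I \<sigma>. local_trajectory (\<Gamma> a) I \<sigma> \<and> {0..b - a} \<subseteq> I \<and> (\<forall>t\<in>{a..b}. \<Gamma> t = \<sigma> (t - a)))"

definition global_trajectory :: "(real \<Rightarrow> real \<times> real) \<Rightarrow> bool" where
  "global_trajectory \<Gamma> \<longleftrightarrow>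
     (\<exists>t :: int \<Rightarrow> real. strict_mono t \<and> filterlim t at_top at_top \<and> filterlim t at_bot at_bot \<and>
        (\<forall>i. trajectory_piece \<Gamma> (t i) (t (i + 1))))"

(* Only the values of \<Gamma> on {0..} matter. *)
definition positive_global_trajectory :: "(real \<Rightarrow> real \<times> real) \<Rightarrow> real \<times> real \<Rightarrow> bool" where
  "positive_global_trajectory \<Gamma> p \<longleftrightarrow> \<Gamma> 0 = p \<and>
     (\<exists>t :: nat \<Rightarrow> real. t 0 = 0 \<and> strict_mono t \<and> filterlim t at_top sequentially \<and>
        (\<forall>i. trajectory_piece \<Gamma> (t i) (t (Suc i))))"

definition invariant :: "(real \<times> real) set \<Rightarrow> bool" where
  "invariant A \<longleftrightarrow> (\<forall>p\<in>A. \<forall>\<Gamma>. global_trajectory \<Gamma> \<and> p \<in> range \<Gamma> \<longrightarrow> range \<Gamma> \<subseteq> A)"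

definition topologically_transitive_on :: "(real \<times> real) set \<Rightarrow> bool" where
  "topologically_transitive_on W \<longleftrightarrow>
     (\<forall>U1 U2. openin (top_of_set W) U1 \<and> U1 \<noteq> {} \<and> openin (top_of_set W) U2 \<and> U2 \<noteq> {} \<longrightarrow>
        (\<exists>q\<in>U1. \<exists>\<Gamma> t0. positive_global_trajectory \<Gamma> q \<and> t0 > 0 \<and> \<Gamma> t0 \<in> U2))"

definition sensitive_on :: "(real \<times> real) set \<Rightarrow> bool" where
  "sensitive_on W \<longleftrightarrow>
     (\<exists>r. 0 < r \<and> r < diameter W \<and>
        (\<forall>x\<in>W. \<forall>\<epsilon>>0. \<exists>y\<in>ball x \<epsilon> \<inter> W. \<exists>\<Gamma>x \<Gamma>y.
           positive_global_trajectory \<Gamma>x x \<and> positive_global_trajectory \<Gamma>y y \<and>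
           sup_distance (\<Gamma>x ` {0..}) (\<Gamma>y ` {0..}) > ereal r))"

definition chaotic_on :: "(real \<times> real) set \<Rightarrow> bool" where
  "chaotic_on W \<longleftrightarrow>
     compact W \<and> invariant W \<and> topologically_transitive_on W \<and> sensitive_on W"

end

end

theory Submission
  imports Defs
begin

text \<open>
  The function \<open>y + x\<^sup>2\<close> is constant along the orbits of \<open>X\<close>, and \<open>y - (x\<^sup>4 - x\<^sup>2) / 2\<close>
  is constant along those of \<open>Y\<close>. In the upper half plane \<open>\<Lambda>\<close> is the set where the first of
  these is at most 1, in the lower half plane the set where the second is nonnegative. So no arc of
  \<open>X\<close> or \<open>Y\<close> can cross the boundary of \<open>\<Lambda>\<close> in either time direction; arcs on the switching line live
  over \<open>2 x\<^sup>2 \<le> 1\<close>, where the line belongs to \<open>\<Lambda>\<close>. This is invariance (\<open>invariant_region\<close>).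

  For chaos, the point is that any two points of \<open>\<Lambda>\<close> are joined by a trajectory
  (\<open>legs_in_region\<close>). On the segment \<open>0 < x\<close>, \<open>2 x\<^sup>2 < 1\<close> of the switching line both fields push
  towards the line, so that trajectories merge there; on \<open>x < 0\<close>, \<open>2 x\<^sup>2 < 1\<close> both push away, so that a
  trajectory may leave at any moment to either side. The sliding field moves left with
  speed \<open>(1 + 2 x\<^sup>2) / (2 (1 - x\<^sup>2))\<close> on both segments and, extended continuously,
  carries trajectories through the origin. Hence:

  \<^item> from every point of \<open>\<Lambda>\<close> some trajectory reaches the switching line, then the merging segment
    (the parabolas of \<open>X\<close> lead from \<open>(-x, 0)\<close> to \<open>(x, 0)\<close>, the quartics of \<open>Y\<close> lead from a sewing point
    \<open>(x, 0)\<close> with \<open>x > 0\<close> to \<open>(u, 0)\<close> with \<open>u\<^sup>2 + x\<^sup>2 = 1\<close>, \<open>u \<ge> 0\<close>), and slides to the origin (\<open>region_to_center\<close>);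
  \<^item> symmetrically, every point of \<open>\<Lambda>\<close> can be traced back along orbits of \<open>X\<close> and \<open>Y\<close> to the
    segment \<open>x \<le> 0\<close>, \<open>2 x\<^sup>2 \<le> 1\<close>, and so is reached from the origin by leaving that segment at the right
    moment (\<open>center_to_region\<close>).

  Transitivity is then immediate. Sensitive dependence comes from non-uniqueness: two
  trajectories from the same point can visit two distant points (\<open>chaotic_onI\<close>). What remains is to extend a finite path to all positive times, which is done
  by running forever around the boundary of \<open>\<Lambda>\<close> (\<open>periodic_trajectory\<close>).
\<close>

section \<open>Concatenating local trajectories\<close>

text \<open>
  A leg starts at time 0 of a local trajectory, and the backward half of that trajectory may then be
  the single instant 0, where being an arc is no condition on the derivative.
\<close>

lemma arc_in_singleton: "arc_in F S {a} \<phi> \<longleftrightarrow> \<phi> a \<in> S"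
  by (simp add: arc_in_def has_vector_derivative_def has_derivative_within_singleton_iff
      bounded_linear_scaleR_left)

context psvf
begin

lemma trajectory_piece_cong:
  assumes "trajectory_piece \<Gamma> a b" and "a \<le> b" and "\<And>t. a \<le> t \<Longrightarrow> t \<le> b \<Longrightarrow> \<Gamma>' (t + c) = \<Gamma> t"
  shows "trajectory_piece \<Gamma>' (a + c) (b + c)"
proof -
  obtain I \<sigma> where I: "local_trajectory (\<Gamma> a) I \<sigma>" "{0..b - a} \<subseteq> I" "\<forall>t\<in>{a..b}. \<Gamma> t = \<sigma> (t - a)"
    using assms(1) unfolding trajectory_piece_def by blast
  have "\<Gamma>' t = \<sigma> (t - (a + c))" if "t \<in> {a + c..b + c}" for t
    using assms(3)[of "t - c"] I(3) that by (simp add: algebra_simps)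
  moreover have "\<Gamma>' (a + c) = \<Gamma> a"
    using assms(2,3) by simp
  ultimately show ?thesis
    unfolding trajectory_piece_def using I by (intro exI[of _ I] exI[of _ \<sigma>]) simp
qed

definition leg :: "real \<times> real \<Rightarrow> real \<times> real \<Rightarrow> bool" where
  "leg p q \<longleftrightarrow> (\<exists>T>0. \<exists>\<sigma>. local_trajectory p {0..T} \<sigma> \<and> \<sigma> 0 = p \<and> \<sigma> T = q)"

text \<open>
  Only the last part of a positive trajectory has to be infinite, so finite paths are built
  backwards, by putting legs in front of a trajectory that already exists for all positive times.
\<close>

lemma prepend_leg:
  assumes "leg p q" and "positive_global_trajectory \<Gamma> q"
  shows "\<exists>\<Gamma>' T. T > 0 \<and> positive_global_trajectory \<Gamma>' p \<and> (\<forall>t\<ge>0. \<Gamma>' (t + T) = \<Gamma> t)"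
proof -
  obtain T \<sigma> where T: "T > 0" and \<sigma>: "local_trajectory p {0..T} \<sigma>" "\<sigma> 0 = p" "\<sigma> T = q"
    using assms(1) unfolding leg_def by blast
  obtain t :: "nat \<Rightarrow> real" where t: "t 0 = 0" "strict_mono t" "filterlim t at_top sequentially"
      "\<And>i. trajectory_piece \<Gamma> (t i) (t (Suc i))" and \<Gamma>0: "\<Gamma> 0 = q"
    using assms(2) unfolding positive_global_trajectory_def by blast
  define \<Gamma>' where "\<Gamma>' s = (if s < T then \<sigma> s else \<Gamma> (s - T))" for s
  define t' where "t' n = (case n of 0 \<Rightarrow> 0 | Suc k \<Rightarrow> t k + T)" for n
  have shift: "\<Gamma>' (s + T) = \<Gamma> s" if "s \<ge> 0" for s
    using that by (simp add: \<Gamma>'_def)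
  have t_nonneg: "t k \<ge> 0" for k
    using strict_mono_less_eq[OF t(2), of 0 k] t(1) by simp
  have "strict_mono t'"
    unfolding strict_mono_Suc_iff
    using t(1,2) T by (auto simp: t'_def strict_mono_Suc_iff split: nat.split)
  moreover have "filterlim t' at_top sequentially"
  proof -
    have "filterlim (\<lambda>k. t' (Suc k)) at_top sequentially"
      unfolding t'_def nat.case
      using filterlim_tendsto_add_at_top[OF tendsto_const[of T] t(3)] by (simp add: add.commute)
    then show ?thesis
      by (simp add: filterlim_sequentially_Suc)
  qed
  moreover have "trajectory_piece \<Gamma>' (t' i) (t' (Suc i))" for i
  proof (cases i)
    case 0
    have "\<Gamma>' s = \<sigma> s" if "0 \<le> s" "s \<le> T" for s
      using that \<sigma>(3) \<Gamma>0 by (auto simp: \<Gamma>'_def)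
    then show ?thesis
      using 0 t(1) \<sigma> T unfolding trajectory_piece_def t'_def
      by (intro exI[of _ "{0..T}"] exI[of _ \<sigma>]) simp
  next
    case (Suc k)
    have "trajectory_piece \<Gamma>' (t k + T) (t (Suc k) + T)"
      by (rule trajectory_piece_cong[OF t(4)])
        (use t(2) t_nonneg[of k] shift in \<open>auto simp: strict_mono_Suc_iff less_imp_le\<close>)
    then show ?thesis
      by (simp add: Suc t'_def)
  qed
  moreover have "\<Gamma>' 0 = p" "t' 0 = 0"
    using T \<sigma>(2) by (simp_all add: \<Gamma>'_def t'_def)
  ultimately have "positive_global_trajectory \<Gamma>' p"
    unfolding positive_global_trajectory_def by blast
  then show ?thesis
    using T shift by blast
qed

lemma prepend_legs:
  assumes "leg\<^sup>+\<^sup>+ p q" and "positive_global_trajectory \<Gamma> q"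
  shows "\<exists>\<Gamma>' T. T > 0 \<and> positive_global_trajectory \<Gamma>' p \<and> (\<forall>t\<ge>0. \<Gamma>' (t + T) = \<Gamma> t)"
  using assms
proof (induction rule: converse_tranclp_induct)
  case (base p)
  then show ?case
    by (rule prepend_leg)
next
  case (step p p')
  then obtain \<Gamma>1 T1 where 1: "T1 > 0" "positive_global_trajectory \<Gamma>1 p'" "\<forall>t\<ge>0. \<Gamma>1 (t + T1) = \<Gamma> t"
    by blast
  obtain \<Gamma>2 T2 where 2: "T2 > 0" "positive_global_trajectory \<Gamma>2 p" "\<forall>t\<ge>0. \<Gamma>2 (t + T2) = \<Gamma>1 t"
    using prepend_leg[OF step.hyps(1) 1(2)] by blast
  have "\<Gamma>2 (t + (T1 + T2)) = \<Gamma> t" if "t \<ge> 0" for t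
    using 1 2 that by (metis add.assoc add_nonneg_nonneg less_imp_le)
  then show ?case
    using 1(1) 2(1,2) by (intro exI[of _ \<Gamma>2] exI[of _ "T1 + T2"]) simp
qed

text \<open>
  An infinite sequence of pieces does make up a trajectory once the switching times tend to infinity;
  the gluing condition makes the choice of piece at a switching time irrelevant.
\<close>

lemma concatenate_pieces:
  assumes t: "t 0 = (0::real)" "strict_mono t" "filterlim t at_top sequentially"
    and \<sigma>: "\<And>n. local_trajectory (\<sigma> n 0) {0..t (Suc n) - t n} (\<sigma> n)"
    and glue: "\<And>n. \<sigma> n (t (Suc n) - t n) = \<sigma> (Suc n) 0"
  shows "\<exists>\<Gamma>. positive_global_trajectory \<Gamma> (\<sigma> 0 0)"
proof -
  \<comment> \<open>At a switching time this selects the earlier of the two adjacent pieces.\<close>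
  define \<Gamma> where "\<Gamma> s = (let n = LEAST n. s \<le> t (Suc n) in \<sigma> n (s - t n))" for s
  have \<Gamma>: "\<Gamma> s = \<sigma> n (s - t n)" if "t n \<le> s" "s \<le> t (Suc n)" for n s
  proof (cases "n > 0 \<and> s = t n")
    case True
    then obtain m where m: "n = Suc m"
      using gr0_implies_Suc by blast
    have "(LEAST n. s \<le> t (Suc n)) = m"
      by (rule Least_equality) (use True m strict_mono_less_eq[OF t(2)] in auto)
    then show ?thesis
      using True m glue[of m] by (simp add: \<Gamma>_def Let_def)
  next
    case False
    have "(LEAST n. s \<le> t (Suc n)) = n"
    proof (rule Least_equality)
      fix k assume k: "s \<le> t (Suc k)"
      show "n \<le> k"
      proof (rule ccontr)
        assume "\<not> n \<le> k"
        then have "t (Suc k) \<le> t n"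
          using strict_mono_less_eq[OF t(2)] by auto
        then show False
          using False k that(1) \<open>\<not> n \<le> k\<close> by auto
      qed
    qed (rule that(2))
    then show ?thesis
      by (simp add: \<Gamma>_def Let_def)
  qed
  have mono: "t n \<le> t (Suc n)" for n
    using strict_mono_less_eq[OF t(2)] by simp
  have "trajectory_piece \<Gamma> (t i) (t (Suc i))" for i
    unfolding trajectory_piece_def
    by (intro exI[of _ "{0..t (Suc i) - t i}"] exI[of _ "\<sigma> i"]) (use \<sigma>[of i] \<Gamma>[of i] mono[of i] in auto)
  moreover have "\<Gamma> 0 = \<sigma> 0 0"
    using \<Gamma>[of 0 0] t(1) mono[of 0] by simp
  ultimately show ?thesis
    unfolding positive_global_trajectory_def using t by blast
qed

section \<open>Criteria for invariance and chaos\<close>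

text \<open>
  A piece uses only the forward half of its local trajectory, and that is a single arc in every case
  except at a singular tangency, where nothing moves.
\<close>

lemma trajectory_piece_cases:
  assumes "trajectory_piece \<Gamma> a b" and "a \<le> b"
  obtains \<sigma> where "\<And>t. t \<in> {a..b} \<Longrightarrow> \<Gamma> t = \<sigma> (t - a)" and "some_arc {0..b - a} \<sigma>"
  | "\<And>t. t \<in> {a..b} \<Longrightarrow> \<Gamma> t = \<Gamma> a"
proof -
  obtain I \<sigma> where I: "local_trajectory (\<Gamma> a) I \<sigma>" "{0..b - a} \<subseteq> I" "\<forall>t\<in>{a..b}. \<Gamma> t = \<sigma> (t - a)"
    using assms(1) unfolding trajectory_piece_def by blast
  have restrict: "some_arc {0..b - a} \<sigma>" if "some_arc J \<sigma>" "I \<inter> {0..} \<subseteq> J" for J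
  proof -
    have "{0..b - a} \<subseteq> J"
      using I(2) that(2) by auto
    then have "arc_in F S {0..b - a} \<sigma>" if "arc_in F S J \<sigma>" for F S
      using that unfolding arc_in_def by (meson has_vector_derivative_within_subset subsetD)
    then show ?thesis
      using that(1) unfolding some_arc_def arc_X_def arc_Y_def arc_Sigma_def by blast
  qed
  from I(1) have "some_arc {0..b - a} \<sigma> \<or> (\<forall>t\<in>I. \<sigma> t = \<Gamma> a)"
    by cases (use restrict in \<open>auto simp: some_arc_def\<close>)
  then show ?thesis
  proof
    assume "some_arc {0..b - a} \<sigma>"
    then show ?thesis
      using that(1) I(3) by blast
  next
    assume "\<forall>t\<in>I. \<sigma> t = \<Gamma> a"
    then show ?thesis
      using that(2) I(2,3) by (metis atLeastAtMost_iff diff_ge_0_iff_ge diff_right_mono subsetD)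
  qed
qed

text \<open>
  Invariance under global trajectories, which extend in both time directions, follows once membership
  propagates both ways along single arcs: it is carried from the piece containing the given point to
  all switching times, hence to all pieces.
\<close>

lemma invariantI:
  assumes arcs: "\<And>\<phi> T s t. some_arc {0..T} \<phi> \<Longrightarrow> s \<in> {0..T} \<Longrightarrow> t \<in> {0..T} \<Longrightarrow> \<phi> s \<in> A \<Longrightarrow> \<phi> t \<in> A"
  shows "invariant A"
  unfolding invariant_def
proof (intro ballI allI impI)
  fix p \<Gamma> assume "p \<in> A" and "global_trajectory \<Gamma> \<and> p \<in> range \<Gamma>"
  then obtain t :: "int \<Rightarrow> real" and s0 where t: "strict_mono t" "filterlim t at_top at_top" "filterlim t at_bot at_bot"
      "\<And>i. trajectory_piece \<Gamma> (t i) (t (i + 1))" and s0: "\<Gamma> s0 \<in> A"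
    unfolding global_trajectory_def by auto
  have mono: "t i \<le> t (i + 1)" for i
    using strict_mono_less_eq[OF t(1)] by simp
  have piece: "\<Gamma> r \<in> A \<longleftrightarrow> \<Gamma> (t i) \<in> A" if "t i \<le> r" "r \<le> t (i + 1)" for r i
    using t(4)[of i] mono[of i]
  proof (cases rule: trajectory_piece_cases)
    case (1 \<sigma>)
    have "\<sigma> (r - t i) \<in> A \<longleftrightarrow> \<sigma> 0 \<in> A"
      using arcs[OF 1(2), of "r - t i" 0] arcs[OF 1(2), of 0 "r - t i"] that by auto
    then show ?thesis
      using 1(1)[of r] 1(1)[of "t i"] that mono[of i] by simp
  next
    case 2
    then show ?thesis
      using that by (metis atLeastAtMost_iff)
  qed
  have knots: "\<Gamma> (t i) \<in> A \<longleftrightarrow> \<Gamma> (t 0) \<in> A" for i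
  proof (induction i rule: int_induct[of _ 0])
    case base
    show ?case by simp
  next
    case (step1 i)
    then show ?case
      using piece[of i "t (i + 1)"] mono[of i] by simp
  next
    case (step2 i)
    then show ?case
      using piece[of "i - 1" "t i"] mono[of "i - 1"] by simp
  qed
  have located: "\<exists>i. t i \<le> r \<and> r \<le> t (i + 1)" for r
  proof -
    obtain l where l: "t l \<le> r"
      using t(3) by (metis eventually_at_bot_linorder filterlim_at_bot order_refl)
    obtain u where "r \<le> t u"
      using t(2) by (metis eventually_at_top_linorder filterlim_at_top order_refl)
    have "\<exists>i. t i \<le> r \<and> r \<le> t (i + 1)" if "r \<le> t u" "l \<le> u" for u
      using that(2,1)
    proof (induction u rule: int_ge_induct)
      case base
      then show ?case
        using l mono[of l] by (intro exI[of _ l]) simp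
    next
      case (step i)
      then show ?case
        by (metis linear)
    qed
    moreover have "r \<le> t (max l u)"
      using \<open>r \<le> t u\<close> strict_mono_less_eq[OF t(1), of u "max l u"] by simp
    ultimately show ?thesis
      by (metis max.cobounded1)
  qed
  have "\<Gamma> r \<in> A" for r
    using located[of r] located[of s0] piece knots s0 by metis
  then show "range \<Gamma> \<subseteq> A"
    by blast
qed

text \<open>
  If any two points are joined by a path, then from every \<open>x\<close> there are trajectories through \<open>a\<close> and
  through \<open>b\<close>. This gives sensitivity with the neighbour \<open>y = x\<close>, since the distance in question is
  a supremum over pairs of points and thus at least the distance of \<open>a\<close> and \<open>b\<close>. The trajectory \<open>\<Gamma>\<close>
  through \<open>c\<close> serves to continue finite paths to all positive times.
\<close>

lemma chaotic_onI:
  assumes "compact W" and "invariant W"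
    and legs: "\<And>p q. p \<in> W \<Longrightarrow> q \<in> W \<Longrightarrow> leg\<^sup>+\<^sup>+ p q"
    and c: "c \<in> W" "positive_global_trajectory \<Gamma> c"
    and "a \<in> W" "b \<in> W" "a \<noteq> b"
  shows "chaotic_on W"
proof -
  have through: "\<exists>\<Gamma> T. T > 0 \<and> positive_global_trajectory \<Gamma> p \<and> \<Gamma> T = q" if pq: "p \<in> W" "q \<in> W" for p q
  proof -
    obtain \<Gamma>1 where 1: "positive_global_trajectory \<Gamma>1 q"
      using prepend_legs[OF legs[OF pq(2) c(1)] c(2)] by blast
    obtain \<Gamma>2 T where "T > 0" "positive_global_trajectory \<Gamma>2 p" "\<forall>t\<ge>0. \<Gamma>2 (t + T) = \<Gamma>1 t"
      using prepend_legs[OF legs[OF pq] 1] by blast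
    then show ?thesis
      using 1 unfolding positive_global_trajectory_def by (metis add_0 order_refl)
  qed
  have "topologically_transitive_on W"
    unfolding topologically_transitive_on_def
  proof (intro allI impI, elim conjE)
    fix U1 U2 assume U: "openin (top_of_set W) U1" "U1 \<noteq> {}" "openin (top_of_set W) U2" "U2 \<noteq> {}"
    then obtain p q where "p \<in> U1" "q \<in> U2" "p \<in> W" "q \<in> W"
      by (metis all_not_in_conv openin_imp_subset subsetD)
    then show "\<exists>q\<in>U1. \<exists>\<Gamma> t0. positive_global_trajectory \<Gamma> q \<and> 0 < t0 \<and> \<Gamma> t0 \<in> U2"
      using through by metis
  qed
  moreover have "sensitive_on W"
    unfolding sensitive_on_def
  proof (intro exI[of _ "dist a b / 2"] conjI ballI allI impI)
    show "0 < dist a b / 2"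
      using assms by simp
    show "dist a b / 2 < diameter W"
      using diameter_bounded_bound[OF compact_imp_bounded[OF assms(1)] \<open>a \<in> W\<close> \<open>b \<in> W\<close>] \<open>a \<noteq> b\<close>
      by (smt (verit) field_sum_of_halves zero_less_dist_iff)
  next
    fix x \<epsilon> assume x: "x \<in> W" "(0::real) < \<epsilon>"
    obtain \<Gamma>a Ta where A: "Ta > 0" "positive_global_trajectory \<Gamma>a x" "\<Gamma>a Ta = a"
      using through[OF x(1) \<open>a \<in> W\<close>] by blast
    obtain \<Gamma>b Tb where B: "Tb > 0" "positive_global_trajectory \<Gamma>b x" "\<Gamma>b Tb = b"
      using through[OF x(1) \<open>b \<in> W\<close>] by blast
    have "(a, b) \<in> \<Gamma>a ` {0..} \<times> \<Gamma>b ` {0..}"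
      using A B by force
    then have "ereal (dist a b) \<le> sup_distance (\<Gamma>a ` {0..}) (\<Gamma>b ` {0..})"
      unfolding sup_distance_def by (intro SUP_upper2[of "(a, b)"]) auto
    moreover have "ereal (dist a b / 2) < ereal (dist a b)"
      using \<open>a \<noteq> b\<close> by simp
    ultimately have "sup_distance (\<Gamma>a ` {0..}) (\<Gamma>b ` {0..}) > ereal (dist a b / 2)"
      by order
    then show "\<exists>y\<in>ball x \<epsilon> \<inter> W. \<exists>\<Gamma>x \<Gamma>y. positive_global_trajectory \<Gamma>x x \<and> positive_global_trajectory \<Gamma>y y \<and>
        ereal (dist a b / 2) < sup_distance (\<Gamma>x ` {0..}) (\<Gamma>y ` {0..})"
      using x A B by (intro bexI[of _ x]) auto
  qed
  ultimately show ?thesis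
    unfolding chaotic_on_def using assms by blast
qed

end

section \<open>The vector field and its orbits\<close>

definition height :: "real \<times> real \<Rightarrow> real" where
  "height = (\<lambda>(x, y). y)"

definition field_up :: "real \<times> real \<Rightarrow> real \<times> real" where
  "field_up = (\<lambda>(x, y). (1, - 2 * x))"

definition field_down :: "real \<times> real \<Rightarrow> real \<times> real" where
  "field_down = (\<lambda>(x, y). (- 2, - 4 * x ^ 3 + 2 * x))"

definition region :: "(real \<times> real) set" where
  "region = {(x, y). - 1 \<le> x \<and> x \<le> 1 \<and> x ^ 4 / 2 - x ^ 2 / 2 \<le> y \<and> y \<le> 1 - x ^ 2}"

lemma height_simp [simp]: "height (x, y) = y"
  by (simp add: height_def)

lemma field_up_simp [simp]: "field_up (x, y) = (1, - 2 * x)"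
  by (simp add: field_up_def)

lemma field_down_simp [simp]: "field_down (x, y) = (- 2, 2 * x * (1 - 2 * x\<^sup>2))"
  by (simp add: field_down_def power2_eq_square power3_eq_cube algebra_simps)

interpretation Z: psvf height field_up field_down .

lemma grad_height [simp]: "grad height p = (0, 1)"
proof -
  have "height = snd"
    by (auto simp: height_def)
  then have D: "GDERIV height p :> (0, 1)"
    unfolding gderiv_def by (auto intro!: derivative_eq_intros simp: inner_prod_def)
  have "D = (0, 1)" if "GDERIV height p :> D" for D
  proof -
    have "(\<lambda>h. h \<bullet> D) = (\<lambda>h. h \<bullet> (0, 1))"
      using has_derivative_unique D that unfolding gderiv_def by blast
    then show ?thesis
      by (metis vector_eq_ldot)
  qed
  then show ?thesis
    unfolding grad_def using D by blast
qed

lemma lie_up [simp]: "lie_deriv field_up height (x, y) = - 2 * x"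
  and lie_down [simp]: "lie_deriv field_down height (x, y) = 2 * x * (1 - 2 * x\<^sup>2)"
  by (simp_all add: lie_deriv_def)

lemma switching_iff [simp]: "(x, y) \<in> Z.switching \<longleftrightarrow> y = 0"
  and upper_iff [simp]: "(x, y) \<in> Z.upper \<longleftrightarrow> y \<ge> 0"
  and lower_iff [simp]: "(x, y) \<in> Z.lower \<longleftrightarrow> y \<le> 0"
  by (simp_all add: Z.switching_def Z.upper_def Z.lower_def)

lemma escaping_iff [simp]: "(x, y) \<in> Z.escaping \<longleftrightarrow> y = 0 \<and> x < 0 \<and> 2 * x\<^sup>2 < 1"
  by (auto simp: Z.escaping_def mult_less_0_iff)

lemma sliding_iff [simp]: "(x, y) \<in> Z.sliding \<longleftrightarrow> y = 0 \<and> x > 0 \<and> 2 * x\<^sup>2 < 1"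
  by (auto simp: Z.sliding_def zero_less_mult_iff)

lemma tangency_iff [simp]: "(x, y) \<in> Z.tangency \<longleftrightarrow> y = 0 \<and> (x = 0 \<or> 2 * x\<^sup>2 = 1)"
  by (auto simp: Z.tangency_def)

text \<open>
  The graphs of \<open>bowl c\<close> are orbits of \<open>Y\<close>: \<open>bowl c z = (z\<^sup>4 - z\<^sup>2) / 2 + c (1 - c) / 2\<close>. The
  level is expressed through \<open>c\<close> so that the crossings with the switching line are visible: they are at
  \<open>z\<^sup>2 = c\<close> and \<open>z\<^sup>2 = 1 - c\<close>, and the orbit is below the line in between. The orbit on the
  boundary of \<open>\<Lambda>\<close> is \<open>bowl 0\<close>.
\<close>

definition bowl :: "real \<Rightarrow> real \<Rightarrow> real" where
  "bowl c z = (z\<^sup>2 - c) * (z\<^sup>2 - (1 - c)) / 2"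

lemma arc_in_field_downI:
  assumes "\<And>t. t \<in> J \<Longrightarrow> c \<le> (x - 2 * t)\<^sup>2 \<and> (x - 2 * t)\<^sup>2 \<le> 1 - c"
  shows "arc_in field_down Z.lower J (\<lambda>t. (x - 2 * t, bowl c (x - 2 * t)))"
  unfolding arc_in_def
proof (intro ballI conjI)
  fix t assume t: "t \<in> J"
  have "((\<lambda>t. bowl c (x - 2 * t)) has_real_derivative 2 * (x - 2 * t) * (1 - 2 * (x - 2 * t)\<^sup>2)) (at t within J)"
    unfolding bowl_def by (auto intro!: derivative_eq_intros) algebra
  moreover have "((\<lambda>t. x - 2 * t) has_vector_derivative -2) (at t within J)"
    by (auto intro!: derivative_eq_intros)
  ultimately show "((\<lambda>t. (x - 2 * t, bowl c (x - 2 * t))) has_vector_derivative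
      field_down (x - 2 * t, bowl c (x - 2 * t))) (at t within J)"
    unfolding field_down_simp has_real_derivative_iff_has_vector_derivative
    by (rule has_vector_derivative_Pair[rotated])
  show "(x - 2 * t, bowl c (x - 2 * t)) \<in> Z.lower"
    using assms[OF t] by (simp add: bowl_def mult_nonneg_nonpos)
qed

lemma arc_in_field_upI:
  assumes "\<And>t. t \<in> J \<Longrightarrow> (x0 + t)\<^sup>2 \<le> c"
  shows "arc_in field_up Z.upper J (\<lambda>t. (x0 + t, c - (x0 + t)\<^sup>2))"
  unfolding arc_in_def
proof (intro ballI conjI)
  fix t assume "t \<in> J"
  have "((\<lambda>t. c - (x0 + t)\<^sup>2) has_real_derivative - 2 * (x0 + t)) (at t within J)"
    by (auto intro!: derivative_eq_intros)
  moreover have "((\<lambda>t. x0 + t) has_vector_derivative 1) (at t within J)"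
    by (auto intro!: derivative_eq_intros)
  ultimately show "((\<lambda>t. (x0 + t, c - (x0 + t)\<^sup>2)) has_vector_derivative
      field_up (x0 + t, c - (x0 + t)\<^sup>2)) (at t within J)"
    unfolding field_up_simp has_real_derivative_iff_has_vector_derivative
    by (rule has_vector_derivative_Pair[rotated])
qed (use assms in simp)

lemma unit_square_le_one: "t \<in> {0..1} \<Longrightarrow> (1 - 2 * t)\<^sup>2 \<le> (1::real)"
  by (simp add: abs_square_le_1 abs_le_iff)

text \<open>
  At the tangencies with \<open>2 x\<^sup>2 = 1\<close> the field \<open>X\<close> is transversal to the line. At the origin both
  fields are tangent, but the tangency of \<open>Y\<close> is visible: the orbit \<open>bowl 0\<close> arrives there from
  \<open>(1, 0)\<close> through the lower half plane.
\<close>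

lemma regular_tangency_eq: "Z.regular_tangency = Z.tangency"
proof -
  have "p \<notin> Z.singular_tangency" for p
  proof
    assume p: "p \<in> Z.singular_tangency"
    then have "lie_deriv field_up height p = 0" and inv: "Z.invisible_Y p" and tan: "p \<in> Z.tangency"
      by (auto simp: Z.singular_tangency_def Z.invisible_X_def)
    then have p: "p = (0, 0)"
      by (cases p) auto
    have "arc_in field_down Z.lower {0..1/2} (\<lambda>t. (1 - 2 * t, bowl 0 (1 - 2 * t)))"
      by (rule arc_in_field_downI) (use unit_square_le_one in auto)
    then have "Z.visible_Y p"
      unfolding Z.visible_Y_def p
      by (intro conjI exI[of _ "\<lambda>t. (1 - 2 * t, bowl 0 (1 - 2 * t))"] exI[of _ "1/2"]) (auto simp: bowl_def)
    then show False
      using inv by (simp add: Z.invisible_Y_def)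
  qed
  then show ?thesis
    by (auto simp: Z.regular_tangency_def)
qed

section \<open>The sliding and escaping dynamics\<close>

text \<open>
  The point \<open>m\<close> is the one where the segment meets the horizontal line through \<open>q\<close>; the sign condition
  says that the two normal components \<open>b\<close> and \<open>d\<close> are opposite, so there is exactly one.
\<close>

lemma filippov_field_height:
  assumes F: "F q = (a, b)" and G: "G q = (c, d)" and "b * d < 0"
  shows "filippov_field height F G q = ((b * c - a * d) / (b - d), 0)"
proof -
  define u where "u = b / (b - d)"
  have bd: "b - d \<noteq> 0"
    using assms(3) by (auto simp: mult_less_0_iff)
  have u: "0 \<le> u" "u \<le> 1" "b + u * (d - b) = 0" "(b * c - a * d) / (b - d) = a + u * (c - a)"
    using assms(3) bd by (auto simp: u_def mult_less_0_iff divide_simps) (simp_all add: algebra_simps)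
  have point: "(1 - v) *\<^sub>R (q + F q) + v *\<^sub>R (q + G q) = q + (a + v * (c - a), b + v * (d - b))" for v
    by (simp add: F G prod_eq_iff algebra_simps)
  let ?m = "q + (a + u * (c - a), 0)"
  have "(THE m. m \<in> closed_segment (q + F q) (q + G q) \<and> grad height q \<bullet> (m - q) = 0) = ?m"
  proof (rule the_equality)
    show "?m \<in> closed_segment (q + F q) (q + G q) \<and> grad height q \<bullet> (?m - q) = 0"
      unfolding in_segment point using u by auto
  next
    fix m assume m: "m \<in> closed_segment (q + F q) (q + G q) \<and> grad height q \<bullet> (m - q) = 0"
    then obtain v where v: "m = q + (a + v * (c - a), b + v * (d - b))"
      unfolding in_segment point by blast
    then have "b + v * (d - b) = 0"
      using m by simp
    then have "(v - u) * (b - d) = 0"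
      using u(3) by (simp add: algebra_simps)
    then show "m = ?m"
      unfolding v using bd u(3) by simp
  qed
  then show ?thesis
    by (simp add: filippov_field_def u(4))
qed

text \<open>
  Speed of the leftward motion on the line, on both the sliding and the escaping segment.
\<close>

definition slide_speed :: "real \<Rightarrow> real" where
  "slide_speed x = (1 + 2 * x\<^sup>2) / (2 * (1 - x\<^sup>2))"

text \<open>
  On the escaping segment the definition reverses both fields and the result; the two reversals
  cancel, so a single formula holds on both sides of the origin.
\<close>

lemma sigma_field0_eq:
  assumes "(x, y) \<in> Z.escaping \<union> Z.sliding"
  shows "Z.sigma_field0 (x, y) = (- slide_speed x, 0)"
proof -
  have x: "x \<noteq> 0" "2 * x\<^sup>2 < 1" and y: "y = 0"
    using assms by auto
  have neg: "(- 2 * x) * (2 * x * (1 - 2 * x\<^sup>2)) < 0"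
  proof -
    have "0 < (2 * x)\<^sup>2 * (1 - 2 * x\<^sup>2)"
      using x by (intro mult_pos_pos) auto
    then show ?thesis
      by (simp add: power2_eq_square mult.assoc)
  qed
  have "1 - x\<^sup>2 \<noteq> 0" "- 2 * x - 2 * x * (1 - 2 * x\<^sup>2) = - 4 * x * (1 - x\<^sup>2)"
    using x by (auto simp: algebra_simps)
  then have speed: "((- 2 * x) * (- 2) - 1 * (2 * x * (1 - 2 * x\<^sup>2))) / (- 2 * x - 2 * x * (1 - 2 * x\<^sup>2))
      = - slide_speed x"
    using x(1) by (simp add: slide_speed_def field_simps)
  have "filippov_field height field_up field_down (x, y) = (- slide_speed x, 0)"
    unfolding speed[symmetric] by (rule filippov_field_height) (use neg in simp_all)
  moreover have "filippov_field height (\<lambda>p. - field_up p) (\<lambda>p. - field_down p) (x, y) = (slide_speed x, 0)"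
  proof (subst filippov_field_height)
    show "- field_up (x, y) = (- 1, 2 * x)" "- field_down (x, y) = (2, - (2 * x * (1 - 2 * x\<^sup>2)))"
      by simp_all
    show "(2 * x) * (- (2 * x * (1 - 2 * x\<^sup>2))) < 0"
      using neg by simp
    have "(2 * x * 2 - (- 1) * (- (2 * x * (1 - 2 * x\<^sup>2)))) / (2 * x - (- (2 * x * (1 - 2 * x\<^sup>2))))
        = - (((- 2 * x) * (- 2) - 1 * (2 * x * (1 - 2 * x\<^sup>2))) / (- 2 * x - 2 * x * (1 - 2 * x\<^sup>2)))"
      by (subst minus_divide_right) simp
    then show "((2 * x * 2 - (- 1) * (- (2 * x * (1 - 2 * x\<^sup>2)))) / (2 * x - (- (2 * x * (1 - 2 * x\<^sup>2)))), 0)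
        = (slide_speed x, 0)"
      unfolding speed by simp
  qed
  ultimately show ?thesis
    unfolding Z.sigma_field0_def by (simp only: uminus_Pair minus_zero if_cancel)
qed

lemma islimpt_escaping_sliding:
  assumes "2 * x\<^sup>2 \<le> 1"
  shows "(x, 0) islimpt (Z.escaping \<union> Z.sliding)"
  unfolding islimpt_approachable
proof (intro allI impI)
  fix e :: real assume "e > 0"
  define d where "d = min (e / 2) (1 / 2)"
  have d: "0 < d" "d < e" "d \<le> 1 / 2"
    using \<open>e > 0\<close> by (auto simp: d_def)
  \<comment> \<open>Shrinking towards 0 enters the open segments from their outer endpoints; the origin
    is moved to the right.\<close>
  define x' where "x' = (if x = 0 then d else x * (1 - d))"
  have abs_x: "\<bar>x\<bar> \<le> 1"
    using assms by (simp flip: abs_square_le_1)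
  have "x' \<noteq> 0" "x' \<noteq> x"
    using d by (auto simp: x'_def)
  moreover have "2 * x'\<^sup>2 < 1"
  proof (cases "x = 0")
    case True
    have "d * d \<le> 1/2 * (1/2)"
      using d by (intro mult_mono) auto
    then show ?thesis
      using True by (simp add: x'_def power2_eq_square)
  next
    case False
    have "x\<^sup>2 * (1 - d)\<^sup>2 < x\<^sup>2 * 1"
      using False d by (intro mult_strict_left_mono) (auto simp: abs_square_less_1)
    then show ?thesis
      unfolding x'_def power_mult_distrib if_not_P[OF False] using assms by linarith
  qed
  moreover have "\<bar>x' - x\<bar> \<le> d"
    using abs_x d by (auto simp: x'_def algebra_simps abs_mult mult_left_le_one_le)
  ultimately show "\<exists>q\<in>Z.escaping \<union> Z.sliding. q \<noteq> (x, 0) \<and> dist q (x, 0) < e"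
    using d by (intro bexI[of _ "(x', 0)"]) (auto simp: dist_Pair_Pair dist_real_def)
qed

lemma sigma_field0_tendsto:
  assumes "2 * x\<^sup>2 \<le> 1"
  shows "(Z.sigma_field0 \<longlongrightarrow> (- slide_speed x, 0)) (at (x, 0) within (Z.escaping \<union> Z.sliding))"
proof (rule Lim_transform_within[where d = 1])
  show "((\<lambda>p. (- slide_speed (fst p), 0)) \<longlongrightarrow> (- slide_speed x, 0))
      (at (x, 0) within (Z.escaping \<union> Z.sliding))"
    unfolding slide_speed_def using assms by (auto intro!: tendsto_eq_intros)
  show "(- slide_speed (fst p), 0) = Z.sigma_field0 p" if "p \<in> Z.escaping \<union> Z.sliding" for p
    using sigma_field0_eq[of "fst p" "snd p"] that by simp
qed simp

text \<open>
  All three tangencies are limit tangency points, because the formula for the speed is continuous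
  there. In particular trajectories may slide through the origin.
\<close>

lemma sigma_domain_iff [simp]: "(x, y) \<in> Z.sigma_domain \<longleftrightarrow> y = 0 \<and> 2 * x\<^sup>2 \<le> 1"
proof
  assume "(x, y) \<in> Z.sigma_domain"
  then show "y = 0 \<and> 2 * x\<^sup>2 \<le> 1"
    by (auto simp: Z.sigma_domain_def Z.limit_tangency_def)
next
  assume *: "y = 0 \<and> 2 * x\<^sup>2 \<le> 1"
  show "(x, y) \<in> Z.sigma_domain"
  proof (cases "(x, y) \<in> Z.escaping \<union> Z.sliding")
    case False
    then have "(x, y) \<in> Z.tangency"
      using * by auto
    then show ?thesis
      using * islimpt_escaping_sliding sigma_field0_tendsto
      unfolding Z.sigma_domain_def Z.limit_tangency_def by blast
  qed (simp add: Z.sigma_domain_def)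
qed

lemma sigma_field_eq:
  assumes "2 * x\<^sup>2 \<le> 1"
  shows "Z.sigma_field (x, 0) = (- slide_speed x, 0)"
proof (cases "(x, 0) \<in> Z.escaping \<union> Z.sliding")
  case True
  then show ?thesis
    by (simp only: Z.sigma_field_def sigma_field0_eq if_True)
next
  case False
  have "Lim (at (x, 0) within (Z.escaping \<union> Z.sliding)) Z.sigma_field0 = (- slide_speed x, 0)"
    using islimpt_escaping_sliding[OF assms] sigma_field0_tendsto[OF assms]
    by (intro tendsto_Lim) (simp_all add: trivial_limit_within)
  then show ?thesis
    using False by (simp only: Z.sigma_field_def if_False)
qed

text \<open>
  A primitive of \<open>1 / slide_speed\<close>: the time that the leftward motion takes from \<open>a\<close> to \<open>b\<close> is
  \<open>slide_clock a - slide_clock b\<close>. It comes from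
  \<open>2 (1 - x\<^sup>2) / (1 + 2 x\<^sup>2) = 3 / (1 + 2 x\<^sup>2) - 1\<close>.
\<close>

definition slide_clock :: "real \<Rightarrow> real" where
  "slide_clock x = 3 / sqrt 2 * arctan (sqrt 2 * x) - x"

lemma slide_clock_deriv:
  assumes "\<bar>x\<bar> < 1"
  shows "(slide_clock has_real_derivative inverse (slide_speed x)) (at x)" and "slide_speed x > 0"
proof -
  have x: "x\<^sup>2 < 1"
    using assms by (simp add: abs_square_less_1)
  have pos: "1 + 2 * x\<^sup>2 > 0"
    by (simp add: add_pos_nonneg)
  have D: "3 / sqrt 2 * (inverse (1 + (sqrt 2 * x)\<^sup>2) * sqrt 2) - 1 = inverse (slide_speed x)"
    using x pos by (simp add: slide_speed_def power_mult_distrib field_simps)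
  show "(slide_clock has_real_derivative inverse (slide_speed x)) (at x)"
    unfolding slide_clock_def D[symmetric]
    by (auto intro!: derivative_eq_intros)
  show "slide_speed x > 0"
    using x pos by (simp add: slide_speed_def)
qed

lemma slide_clock_strict_mono: "-1 < x \<Longrightarrow> x < y \<Longrightarrow> y < 1 \<Longrightarrow> slide_clock x < slide_clock y"
  by (rule DERIV_pos_imp_increasing)
    (auto intro!: exI slide_clock_deriv simp: abs_less_iff)

lemma square_between:
  fixes a b z :: real
  assumes "a \<le> z" "z \<le> b" "a\<^sup>2 \<le> c" "b\<^sup>2 \<le> c"
  shows "z\<^sup>2 \<le> c"
proof (cases "z \<ge> 0")
  case True
  then show ?thesis
    using assms by (smt (verit) power_mono)
next
  case False
  then have "(- z)\<^sup>2 \<le> (- a)\<^sup>2"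
    using assms by (intro power_mono) auto
  then show ?thesis
    using assms by simp
qed

lemma leg_of_slide_arc:
  assumes "2 * a\<^sup>2 \<le> 1" "0 < T" "x 0 = a" "x T = b" "Z.arc_Sigma {0..T} (\<lambda>t. (x t, 0))"
  shows "Z.leg (a, 0) (b, 0)"
proof -
  have J: "{0..T} \<inter> {..0} = {0}" "{0..T} \<inter> {0..} = {0..T}"
    using assms(2) by auto
  have start: "Z.arc_Sigma {0} (\<lambda>t. (x t, 0))"
    using assms(1,3) by (simp add: Z.arc_Sigma_def arc_in_singleton)
  consider "(a, 0) \<in> Z.escaping" | "(a, 0) \<in> Z.sliding" | "(a, 0) \<in> Z.regular_tangency"
    using assms(1) unfolding regular_tangency_eq escaping_iff sliding_iff tangency_iff by linarith
  then have "Z.local_trajectory (a, 0) {0..T} (\<lambda>t. (x t, 0))"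
  proof cases
    case 1
    show ?thesis
      by (rule Z.escape) (use 1 J start assms in \<open>simp_all add: is_interval_cc Z.some_arc_def\<close>)
  next
    case 2
    show ?thesis
      by (rule Z.slide) (use 2 J start assms in \<open>simp_all add: is_interval_cc Z.some_arc_def\<close>)
  next
    case 3
    show ?thesis
      by (rule Z.regular) (use 3 J start assms in \<open>simp_all add: is_interval_cc Z.some_arc_def\<close>)
  qed
  then show ?thesis
    unfolding Z.leg_def using assms(2-4)
    by (intro exI[of _ T] conjI exI[of _ "\<lambda>t. (x t, 0)"]) simp_all
qed

text \<open>
  The solution \<open>x\<close> is found by separation of variables, as \<open>slide_clock (x t) = slide_clock a - t\<close>;
  the inverse function theorem gives its derivative.
\<close>

lemma leg_slideI:
  assumes "b < a" "2 * a\<^sup>2 \<le> 1" "2 * b\<^sup>2 \<le> 1"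
  shows "Z.leg (a, 0) (b, 0)"
proof -
  \<comment> \<open>The clock is inverted on an open interval larger than the segment, so that endpoints of the
    motion need no one-sided inverse function theorem.\<close>
  define S :: "real set" where "S = {-1<..<1}"
  define T where "T = slide_clock a - slide_clock b"
  define x where "x t = the_inv_into S slide_clock (slide_clock a - t)" for t
  have inj: "inj_on slide_clock S"
    by (rule linorder_inj_onI) (use slide_clock_strict_mono in \<open>force simp: S_def\<close>)+
  have ab: "\<bar>a\<bar> < 1" "\<bar>b\<bar> < 1"
    using assms by (simp_all flip: abs_square_less_1)
  have T: "T > 0"
    unfolding T_def using slide_clock_strict_mono[of b a] ab assms by auto
  have cont: "continuous_on S slide_clock"
    by (rule DERIV_continuous_on)
      (auto intro: has_field_derivative_at_within[OF slide_clock_deriv(1)] simp: S_def abs_less_iff)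
  have x: "x t \<in> S" "b \<le> x t" "x t \<le> a" "slide_clock (x t) = slide_clock a - t" if "t \<in> {0..T}" for t
  proof -
    have "continuous_on {b..a} slide_clock"
      by (rule continuous_on_subset[OF cont]) (use ab in \<open>auto simp: S_def\<close>)
    moreover have "slide_clock b \<le> slide_clock a - t" "slide_clock a - t \<le> slide_clock a"
      using that by (simp_all add: T_def)
    ultimately obtain z where z: "b \<le> z" "z \<le> a" "slide_clock z = slide_clock a - t"
      using IVT'[of slide_clock b "slide_clock a - t" a] assms(1) by auto
    then have "z \<in> S"
      using ab by (auto simp: S_def)
    then have "x t = z"
      unfolding x_def z(3)[symmetric] by (rule the_inv_into_f_f[OF inj])
    then show "x t \<in> S" "b \<le> x t" "x t \<le> a" "slide_clock (x t) = slide_clock a - t"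
      using z \<open>z \<in> S\<close> by auto
  qed
  have "Z.arc_Sigma {0..T} (\<lambda>t. (x t, 0))"
    unfolding Z.arc_Sigma_def arc_in_def
  proof (intro ballI conjI)
    fix t assume t: "t \<in> {0..T}"
    have abs_x: "\<bar>x t\<bar> < 1"
      using x(1)[OF t] by (auto simp: S_def)
    have "2 * (x t)\<^sup>2 \<le> 1"
      using square_between[OF x(2,3)[OF t], of "1/2"] assms by simp
    then show "(x t, 0) \<in> Z.sigma_domain"
      by simp
    have "(the_inv_into S slide_clock has_derivative (*) (slide_speed (x t))) (at (slide_clock (x t)))"
    proof (rule has_derivative_inverse_strong[where f = slide_clock and x = "x t" and S = S and
          f' = "(*) (inverse (slide_speed (x t)))"])
      show "open S" "x t \<in> S" "continuous_on S slide_clock"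
        using x(1)[OF t] cont by (auto simp: S_def)
      show "the_inv_into S slide_clock (slide_clock z) = z" if "z \<in> S" for z
        by (rule the_inv_into_f_f[OF inj that])
      show "(slide_clock has_derivative (*) (inverse (slide_speed (x t)))) (at (x t))"
        using slide_clock_deriv(1)[OF abs_x] by (simp add: has_field_derivative_def)
      show "(*) (inverse (slide_speed (x t))) \<circ> (*) (slide_speed (x t)) = id"
        using slide_clock_deriv(2)[OF abs_x] by (auto simp: fun_eq_iff)
    qed
    then have "(the_inv_into S slide_clock has_real_derivative slide_speed (x t)) (at (slide_clock a - t))"
      by (simp add: x(4)[OF t] has_field_derivative_def)
    moreover have "((\<lambda>t. slide_clock a - t) has_real_derivative - 1) (at t within {0..T})"
      by (auto intro!: derivative_eq_intros)
    ultimately have "((\<lambda>t. the_inv_into S slide_clock (slide_clock a - t)) has_real_derivative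
        slide_speed (x t) * - 1) (at t within {0..T})"
      by (rule DERIV_chain'[rotated])
    then have "(x has_real_derivative - slide_speed (x t)) (at t within {0..T})"
      unfolding x_def by simp
    then show "((\<lambda>t. (x t, 0)) has_vector_derivative Z.sigma_field (x t, 0)) (at t within {0..T})"
      unfolding sigma_field_eq[OF \<open>2 * (x t)\<^sup>2 \<le> 1\<close>] has_real_derivative_iff_has_vector_derivative
      by (rule has_vector_derivative_Pair) simp
  qed
  moreover have "a \<in> S" "b \<in> S"
    using ab by (auto simp: S_def)
  then have "x 0 = a" "x T = b"
    unfolding x_def T_def by (simp_all add: the_inv_into_f_f[OF inj])
  ultimately show ?thesis
    using leg_of_slide_arc[of a T x b] T assms by blast
qed

section \<open>Connecting the points of the region\<close>

text \<open>
  The start condition excludes the points of the line with \<open>x \<ge> 0\<close>, where \<open>X\<close> does not enter the upper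
  half plane. For \<open>x < 0\<close> on the line, an arc of \<open>X\<close> is available whether the point is escaping, a
  tangency or a sewing point.
\<close>

lemma leg_upI:
  assumes "x < x'" "x\<^sup>2 \<le> c" "x'\<^sup>2 \<le> c" and start: "x\<^sup>2 < c \<or> x < 0"
  shows "Z.leg (x, c - x\<^sup>2) (x', c - x'\<^sup>2)"
proof -
  let ?\<phi> = "\<lambda>t. (x + t, c - (x + t)\<^sup>2)"
  have arc: "Z.arc_X {0..x' - x} ?\<phi>"
    unfolding Z.arc_X_def
    by (rule arc_in_field_upI) (use assms square_between[of x _ x' c] in auto)
  have "Z.local_trajectory (x, c - x\<^sup>2) {0..x' - x} ?\<phi>"
  proof (cases "x\<^sup>2 < c")
    case True
    then show ?thesis
      using arc assms by (intro Z.above) (auto simp: is_interval_cc)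
  next
    case False
    then have c: "c = x\<^sup>2" and "x < 0"
      using assms by auto
    have arc': "Z.arc_X ({0..x' - x} \<inter> {0..}) ?\<phi>" "{0..x' - x} \<inter> {..0} = {0}"
      using arc assms(1) by (auto simp: Int_absorb2)
    consider "2 * x\<^sup>2 < 1" | "2 * x\<^sup>2 = 1" | "2 * x\<^sup>2 > 1"
      by linarith
    then show ?thesis
    proof cases
      case 1
      show ?thesis
        by (rule Z.escape)
          (use 1 c \<open>x < 0\<close> arc' assms in \<open>simp_all add: is_interval_cc Z.arc_Sigma_def arc_in_singleton Z.some_arc_def\<close>)
    next
      case 2
      show ?thesis
        by (rule Z.regular)
          (use 2 c \<open>x < 0\<close> arc' assms in \<open>simp_all add: is_interval_cc Z.arc_X_def arc_in_singleton Z.some_arc_def regular_tangency_eq\<close>)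
    next
      case 3
      show ?thesis
        by (rule Z.sewing_up)
          (use 3 c \<open>x < 0\<close> arc' assms in \<open>simp_all add: is_interval_cc Z.arc_Y_def arc_in_singleton mult_neg_neg\<close>)
    qed
  qed
  then show ?thesis
    unfolding Z.leg_def using assms(1)
    by (intro exI[of _ "x' - x"] conjI exI[of _ ?\<phi>]) auto
qed

text \<open>
  Since \<open>bowl c\<close> is a function of \<open>z\<^sup>2\<close> that is nonpositive exactly on \<open>{c..1 - c}\<close>, it is enough to control
  the two ends as long as \<open>z\<close> does not change sign. The last two start conditions describe the points of
  the line where \<open>Y\<close> enters the lower half plane: by sewing, or by escaping and through the visible
  tangency at the origin.
\<close>

lemma leg_downI:
  assumes "x' < x" "0 \<le> x' \<or> x \<le> 0" "c \<le> x\<^sup>2" "x\<^sup>2 \<le> 1 - c" "c \<le> x'\<^sup>2" "x'\<^sup>2 \<le> 1 - c"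
    and start: "c < x\<^sup>2 \<and> x\<^sup>2 < 1 - c \<or> x > 0 \<and> 2 * x\<^sup>2 > 1 \<or> x \<le> 0 \<and> 2 * x\<^sup>2 < 1"
  shows "Z.leg (x, bowl c x) (x', bowl c x')"
proof -
  let ?T = "(x - x') / 2"
  let ?\<phi> = "\<lambda>t. (x - 2 * t, bowl c (x - 2 * t))"
  have between: "c \<le> z\<^sup>2 \<and> z\<^sup>2 \<le> 1 - c" if "x' \<le> z" "z \<le> x" for z
  proof
    show "z\<^sup>2 \<le> 1 - c"
      using that assms by (intro square_between[of x' z x])
    show "c \<le> z\<^sup>2"
    proof (cases "0 \<le> x'")
      case True
      then have "x'\<^sup>2 \<le> z\<^sup>2"
        using that by (intro power_mono)
      then show ?thesis
        using assms by simp
    next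
      case False
      then have "(- x)\<^sup>2 \<le> (- z)\<^sup>2"
        using that assms by (intro power_mono) auto
      then show ?thesis
        using assms by simp
    qed
  qed
  have arc: "Z.arc_Y {0..?T} ?\<phi>"
    unfolding Z.arc_Y_def
    by (rule arc_in_field_downI) (intro between, auto simp: field_simps)
  have "Z.local_trajectory (x, bowl c x) {0..?T} ?\<phi>"
  proof (cases "c < x\<^sup>2 \<and> x\<^sup>2 < 1 - c")
    case True
    then have "bowl c x < 0"
      by (simp add: bowl_def mult_pos_neg)
    then show ?thesis
      using arc assms by (intro Z.below) (auto simp: is_interval_cc)
  next
    case False
    then have b: "bowl c x = 0"
      using assms by (auto simp: bowl_def)
    have arc': "Z.arc_Y ({0..?T} \<inter> {0..}) ?\<phi>" "{0..?T} \<inter> {..0} = {0}"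
      using arc assms(1) by (auto simp: Int_absorb2)
    consider "x > 0" "2 * x\<^sup>2 > 1" | "x < 0" "2 * x\<^sup>2 < 1" | "x = 0"
      using False start by linarith
    then show ?thesis
    proof cases
      case 1
      show ?thesis
        by (rule Z.sewing_down)
          (use 1 b arc' assms in \<open>simp_all add: is_interval_cc Z.arc_X_def arc_in_singleton mult_pos_neg\<close>)
    next
      case 2
      show ?thesis
        by (rule Z.escape)
          (use 2 b arc' assms in \<open>simp_all add: is_interval_cc Z.arc_Sigma_def arc_in_singleton Z.some_arc_def\<close>)
    next
      case 3
      show ?thesis
        by (rule Z.regular)
          (use 3 b arc' assms in \<open>simp_all add: is_interval_cc Z.arc_X_def arc_in_singleton Z.some_arc_def regular_tangency_eq\<close>)
    qed
  qed
  then show ?thesis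
    unfolding Z.leg_def using assms(1)
    by (intro exI[of _ ?T] conjI exI[of _ ?\<phi>]) (use assms(1) in \<open>auto simp: diff_divide_distrib\<close>)
qed

lemma bowl_root [simp]: "x\<^sup>2 = c \<or> x\<^sup>2 = 1 - c \<Longrightarrow> bowl c x = 0"
  by (auto simp: bowl_def)

lemma region_upper_iff:
  assumes "y \<ge> 0"
  shows "(x, y) \<in> region \<longleftrightarrow> y + x\<^sup>2 \<le> 1"
proof
  assume le: "y + x\<^sup>2 \<le> 1"
  then have x: "x\<^sup>2 \<le> 1"
    using assms by simp
  then have "x\<^sup>2 * x\<^sup>2 \<le> x\<^sup>2 * 1"
    by (intro mult_left_mono) auto
  moreover have "\<bar>x\<bar> \<le> 1"
    using x by (simp only: abs_square_le_1)
  ultimately show "(x, y) \<in> region"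
    using assms le by (simp add: region_def abs_le_iff power4_eq_xxxx power2_eq_square mult.assoc)
qed (simp add: region_def)

lemma bowl_0: "bowl 0 x = x ^ 4 / 2 - x ^ 2 / 2"
  by (simp add: bowl_def field_simps power4_eq_xxxx power2_eq_square)

lemma region_lower_iff:
  assumes "y \<le> 0"
  shows "(x, y) \<in> region \<longleftrightarrow> bowl 0 x \<le> y"
proof
  assume le: "bowl 0 x \<le> y"
  have x: "x\<^sup>2 \<le> 1"
  proof (rule ccontr)
    assume "\<not> x\<^sup>2 \<le> 1"
    then have "bowl 0 x > 0"
      by (auto simp: bowl_def intro!: mult_pos_pos)
    then show False
      using le assms by simp
  qed
  then have "\<bar>x\<bar> \<le> 1"
    by (simp only: abs_square_le_1)
  then show "(x, y) \<in> region"
    using assms le x by (simp add: region_def abs_le_iff bowl_0)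
qed (simp add: region_def bowl_0)

text \<open>
  A point of \<open>\<Lambda>\<close> below the line lies strictly inside the arc of some \<open>bowl c\<close>; the value of \<open>c\<close> is the
  smaller root of \<open>c (1 - c) = 2 y + x\<^sup>2 - x\<^sup>4\<close>.
\<close>

lemma region_lower_cases:
  assumes "(x, y) \<in> region" "y < 0"
  obtains c where "0 \<le> c" "2 * c < 1" "y = bowl c x" "c < x\<^sup>2" "x\<^sup>2 < 1 - c"
proof -
  define w where "w = x\<^sup>2"
  define e where "e = 2 * y + w - w\<^sup>2"
  define c where "c = (1 - sqrt (1 - 4 * e)) / 2"
  have e: "e \<ge> 0"
    using assms region_lower_iff[of y x] by (simp add: bowl_def e_def w_def power2_eq_square algebra_simps)
  have "1 - 4 * e = (2 * w - 1)\<^sup>2 - 8 * y"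
    by (simp add: e_def power2_eq_square algebra_simps)
  then have pos: "1 - 4 * e > 0"
    using assms(2) by (smt (verit) zero_le_power2)
  have "0 \<le> c" "2 * c < 1"
    using e pos by (simp_all add: c_def)
  moreover have "c * (1 - c) = e"
    using pos by (simp add: c_def field_simps flip: power2_eq_square)
  then have y: "2 * y = (w - c) * (w - (1 - c))"
    by (simp add: e_def algebra_simps power2_eq_square)
  then have "(w - c) * (w - (1 - c)) < 0"
    using assms(2) by linarith
  then have "c < w" "w < 1 - c"
    using \<open>2 * c < 1\<close> by (auto simp: mult_less_0_iff)
  moreover have "y = bowl c x"
    using y by (simp add: bowl_def w_def)
  ultimately show ?thesis
    using that by (simp add: w_def)
qed

text \<open>
  A point with \<open>x < 0\<close> is moved by \<open>X\<close> to its mirror image, a sewing point with \<open>x > 0\<close> by \<open>Y\<close> to the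
  sliding segment, and there the motion is to the origin.
\<close>

lemma axis_to_center:
  assumes "\<bar>x\<bar> \<le> 1"
  shows "Z.leg\<^sup>*\<^sup>* (x, 0) (0, 0)"
proof -
  have slide: "Z.leg\<^sup>*\<^sup>* (x, 0) (0, 0)" if "0 \<le> x" "2 * x\<^sup>2 \<le> 1" for x
    using that leg_slideI[of 0 x] by (cases "x = 0") auto
  have right: "Z.leg\<^sup>*\<^sup>* (x, 0) (0, 0)" if x: "0 \<le> x" "x \<le> 1" for x
  proof (cases "2 * x\<^sup>2 \<le> 1")
    case True
    then show ?thesis
      using slide x by simp
  next
    case False
    have sq: "x\<^sup>2 \<le> 1"
      using x by (simp add: power_le_one)
    define u where "u = sqrt (1 - x\<^sup>2)"
    have u: "u \<ge> 0" "u\<^sup>2 = 1 - x\<^sup>2"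
      using sq by (simp_all add: u_def)
    have "u < x"
      by (rule power2_less_imp_less) (use u False x in auto)
    have "Z.leg (x, bowl (1 - x\<^sup>2) x) (u, bowl (1 - x\<^sup>2) u)"
      by (rule leg_downI) (use u \<open>u < x\<close> False x in auto)
    then have "Z.leg (x, 0) (u, 0)"
      using u by simp
    then show ?thesis
      using slide[of u] u False by (simp add: converse_rtranclp_into_rtranclp)
  qed
  show ?thesis
  proof (cases "x \<ge> 0")
    case True
    then show ?thesis
      using right assms by simp
  next
    case False
    then have "Z.leg (x, 0) (- x, 0)"
      using leg_upI[of x "- x" "x\<^sup>2"] by simp
    then show ?thesis
      using right[of "- x"] assms False by (simp add: converse_rtranclp_into_rtranclp)
  qed
qed

text \<open>
  Following \<open>X\<close> above the line, or \<open>Y\<close> below it, up to the first crossing reduces this to points of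
  the line. Orbits of \<open>Y\<close> run to the left, so for \<open>x > 0\<close> the crossing is the inner one and for
  \<open>x < 0\<close> the outer one.
\<close>

lemma region_to_center:
  assumes "p \<in> region"
  shows "Z.leg\<^sup>*\<^sup>* p (0, 0)"
proof -
  obtain x y where p: "p = (x, y)"
    by (cases p)
  consider "y > 0" | "y = 0" | "y < 0"
    by linarith
  then have "\<exists>z. \<bar>z\<bar> \<le> 1 \<and> (p = (z, 0) \<or> Z.leg p (z, 0))"
  proof cases
    case 1
    define z where "z = sqrt (y + x\<^sup>2)"
    have z: "z \<ge> 0" "z\<^sup>2 = y + x\<^sup>2"
      using 1 by (simp_all add: z_def)
    have le: "\<bar>z\<bar> \<le> 1"
      using z assms 1 region_upper_iff[of y x] p by (simp only: flip: abs_square_le_1)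
    have "x < z"
      using z 1 by (smt (verit) power2_le_imp_le power_mono)
    then have "Z.leg p (z, 0)"
      using leg_upI[of x z "y + x\<^sup>2"] z 1 p by simp
    then show ?thesis
      using le by blast
  next
    case 2
    then show ?thesis
      using assms p by (auto simp: region_def abs_le_iff intro!: exI[of _ x])
  next
    case 3
    then obtain c where c: "0 \<le> c" "2 * c < 1" "y = bowl c x" "c < x\<^sup>2" "x\<^sup>2 < 1 - c"
      using region_lower_cases assms p by blast
    define z where "z = (if x > 0 then sqrt c else - sqrt (1 - c))"
    have z: "z\<^sup>2 = (if x > 0 then c else 1 - c)"
      using c by (simp add: z_def)
    have le: "\<bar>z\<bar> \<le> 1"
      using z c by (simp flip: abs_square_le_1)
    have "z < x"
      using c real_less_lsqrt[of x c] real_less_rsqrt[of "- x" "1 - c"] unfolding z_def by auto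
    have "Z.leg (x, bowl c x) (z, bowl c z)"
      by (rule leg_downI) (use c z \<open>z < x\<close> in \<open>auto simp: z_def\<close>)
    then show ?thesis
      using le z p c(3) by (auto split: if_splits)
  qed
  then show ?thesis
    using axis_to_center by (metis converse_rtranclp_into_rtranclp)
qed

text \<open>
  The same orbits traced back in time: every point is on an orbit that starts at some point of the
  line. The points of the line with \<open>x > 0\<close> come from their mirror images by \<open>X\<close>, the sewing points with
  \<open>x < 0\<close> come by \<open>Y\<close> from the escaping segment or the origin, and what is left is reached by sliding.
\<close>

lemma center_to_region:
  assumes "p \<in> region"
  shows "Z.leg\<^sup>*\<^sup>* (0, 0) p"
proof -
  have slide: "Z.leg\<^sup>*\<^sup>* (0, 0) (x, 0)" if "x \<le> 0" "2 * x\<^sup>2 \<le> 1" for x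
    using that leg_slideI[of x 0] by (cases "x = 0") auto
  have left: "Z.leg\<^sup>*\<^sup>* (0, 0) (x, 0)" if x: "x \<le> 0" "- 1 \<le> x" for x
  proof (cases "2 * x\<^sup>2 \<le> 1")
    case True
    then show ?thesis
      using slide x by simp
  next
    case False
    have sq: "x\<^sup>2 \<le> 1"
      using x by (simp add: abs_square_le_1)
    define u where "u = sqrt (1 - x\<^sup>2)"
    have u: "u \<ge> 0" "u\<^sup>2 = 1 - x\<^sup>2"
      using sq by (simp_all add: u_def)
    have "u < - x"
      by (rule power2_less_imp_less) (use u False x in auto)
    have "Z.leg (- u, bowl (1 - x\<^sup>2) (- u)) (x, bowl (1 - x\<^sup>2) x)"
      by (rule leg_downI) (use u \<open>u < - x\<close> False x in auto)
    then have "Z.leg (- u, 0) (x, 0)"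
      using u by simp
    then show ?thesis
      using slide[of "- u"] u False by (simp add: rtranclp.rtrancl_into_rtrancl)
  qed
  have axis: "Z.leg\<^sup>*\<^sup>* (0, 0) (x, 0)" if "\<bar>x\<bar> \<le> 1" for x
  proof (cases "x \<le> 0")
    case True
    then show ?thesis
      using left that by simp
  next
    case False
    then have "Z.leg (- x, 0) (x, 0)"
      using leg_upI[of "- x" x "x\<^sup>2"] by simp
    then show ?thesis
      using left[of "- x"] that False by (simp add: rtranclp.rtrancl_into_rtrancl)
  qed
  obtain x y where p: "p = (x, y)"
    by (cases p)
  consider "y > 0" | "y = 0" | "y < 0"
    by linarith
  then have "\<exists>z. \<bar>z\<bar> \<le> 1 \<and> (p = (z, 0) \<or> Z.leg (z, 0) p)"
  proof cases
    case 1
    define z where "z = - sqrt (y + x\<^sup>2)"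
    have z: "z \<le> 0" "z\<^sup>2 = y + x\<^sup>2"
      using 1 by (simp_all add: z_def)
    have le: "\<bar>z\<bar> \<le> 1"
      using z assms 1 region_upper_iff[of y x] p by (simp only: flip: abs_square_le_1)
    have "z < x"
      using z 1 by (smt (verit) power2_le_imp_le power_mono power2_minus)
    moreover have "z < 0"
      using 1 by (simp add: z_def add_pos_nonneg)
    ultimately have "Z.leg (z, 0) p"
      using leg_upI[of z x "y + x\<^sup>2"] z 1 p by simp
    then show ?thesis
      using le by blast
  next
    case 2
    then show ?thesis
      using assms p by (auto simp: region_def abs_le_iff intro!: exI[of _ x])
  next
    case 3
    then obtain c where c: "0 \<le> c" "2 * c < 1" "y = bowl c x" "c < x\<^sup>2" "x\<^sup>2 < 1 - c"
      using region_lower_cases assms p by blast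
    define z where "z = (if x > 0 then sqrt (1 - c) else - sqrt c)"
    have z: "z\<^sup>2 = (if x > 0 then 1 - c else c)"
      using c by (simp add: z_def)
    have le: "\<bar>z\<bar> \<le> 1"
      using z c by (simp flip: abs_square_le_1)
    have "x < z"
      using c real_less_lsqrt[of "- x" c] real_less_rsqrt[of x "1 - c"] unfolding z_def
      by (cases "x = 0") auto
    have "Z.leg (z, bowl c z) (x, bowl c x)"
      by (rule leg_downI) (use c z \<open>x < z\<close> in \<open>auto simp: z_def\<close>)
    then show ?thesis
      using le z p c(3) by (auto split: if_splits)
  qed
  then show ?thesis
    using axis by (metis rtranclp.rtrancl_into_rtrancl)
qed

text \<open>
  The loop through \<open>(-1, 0)\<close> makes the path through the origin nontrivial even if both given points are
  the origin, so that positive time elapses.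
\<close>

lemma legs_in_region:
  assumes "p \<in> region" "q \<in> region"
  shows "Z.leg\<^sup>+\<^sup>+ p q"
proof -
  have "Z.leg (0, 0) (- 1, 0)"
    using leg_downI[of "- 1" 0 0] by simp
  moreover have "Z.leg\<^sup>*\<^sup>* (- 1, 0) (0, 0)"
    by (rule axis_to_center) simp
  ultimately show ?thesis
    using region_to_center[OF assms(1)] center_to_region[OF assms(2)]
    by (meson rtranclp_into_tranclp1 tranclp_rtranclp_tranclp)
qed

text \<open>
  The boundary of \<open>\<Lambda>\<close>: the parabola of \<open>X\<close> from \<open>(-1, 0)\<close> to \<open>(1, 0)\<close> takes time 2, and the orbit of \<open>Y\<close>
  back, through its visible tangency at the origin, takes time 1.
\<close>

lemma periodic_trajectory: "\<exists>\<Gamma>. Z.positive_global_trajectory \<Gamma> (- 1, 0)"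
proof -
  \<comment> \<open>The switching times 0, 2, 3, 5, 6, ...\<close>
  define t :: "nat \<Rightarrow> real" where "t n = (3 * n + (if odd n then 1 else 0)) / 2" for n
  define up where "up = (\<lambda>t::real. (- 1 + t, 1 - (- 1 + t)\<^sup>2))"
  define down where "down = (\<lambda>t. (1 - 2 * t, bowl 0 (1 - 2 * t)))"
  define \<sigma> where "\<sigma> n = (if even n then up else down)" for n :: nat
  have "Z.arc_X {0..2} up"
    unfolding Z.arc_X_def up_def by (rule arc_in_field_upI) (auto simp: abs_square_le_1 abs_le_iff)
  then have up: "Z.local_trajectory (- 1, 0) {0..2} up"
    by (intro Z.sewing_up) (auto simp: is_interval_cc Z.arc_Y_def arc_in_singleton Int_absorb2 up_def)
  have "Z.arc_Y {0..1} down"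
    unfolding Z.arc_Y_def down_def by (rule arc_in_field_downI) (use unit_square_le_one in auto)
  then have down: "Z.local_trajectory (1, 0) {0..1} down"
    by (intro Z.sewing_down) (auto simp: is_interval_cc Z.arc_X_def arc_in_singleton Int_absorb2 down_def)
  have dt: "t (Suc n) - t n = (if even n then 2 else 1)" for n
    by (simp add: t_def field_simps)
  have "\<exists>\<Gamma>. Z.positive_global_trajectory \<Gamma> (\<sigma> 0 0)"
  proof (rule Z.concatenate_pieces)
    show "t 0 = 0" "strict_mono t"
      by (auto simp: t_def strict_mono_Suc_iff)
    show "filterlim t at_top sequentially"
      by (rule filterlim_at_top_mono[OF filterlim_real_sequentially]) (auto simp: t_def)
    show "Z.local_trajectory (\<sigma> n 0) {0..t (Suc n) - t n} (\<sigma> n)" for n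
      unfolding dt using up down by (simp add: \<sigma>_def up_def down_def)
    show "\<sigma> n (t (Suc n) - t n) = \<sigma> (Suc n) 0" for n
      unfolding dt by (simp add: \<sigma>_def up_def down_def)
  qed
  then show ?thesis
    by (simp add: \<sigma>_def up_def)
qed

section \<open>Compactness and invariance of the region\<close>

lemma compact_region: "compact region"
proof -
  have "region = {p. - 1 \<le> fst p} \<inter> {p. fst p \<le> 1} \<inter> {p. fst p ^ 4 / 2 - fst p ^ 2 / 2 \<le> snd p}
      \<inter> {p. snd p \<le> 1 - fst p ^ 2}"
    by (auto simp: region_def)
  also have "closed \<dots>"
    by (intro closed_Int closed_Collect_le continuous_intros) auto
  finally have "closed region" .
  moreover have "region \<subseteq> {- 1..1} \<times> {- 1..1}"
  proof
    fix p assume "p \<in> region"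
    then obtain x y where p: "p = (x, y)" "- 1 \<le> x" "x \<le> 1" "x ^ 4 / 2 - x ^ 2 / 2 \<le> y" "y \<le> 1 - x ^ 2"
      by (auto simp: region_def)
    have "x\<^sup>2 \<le> 1" "x ^ 4 \<ge> 0" "x\<^sup>2 \<ge> 0"
      using p by (simp_all add: abs_square_le_1 abs_le_iff)
    then have "- 1 \<le> y" "y \<le> 1"
      using p(4,5) by linarith+
    then show "p \<in> {- 1..1} \<times> {- 1..1}"
      using p by simp
  qed
  then have "bounded region"
    by (rule bounded_subset[rotated]) (intro bounded_Times bounded_closed_interval)
  ultimately show ?thesis
    by (simp add: compact_eq_bounded_closed)
qed

text \<open>
  A first integral of \<open>F\<close> is constant along its arcs. The hypothesis is stated with the coordinates
  \<open>x\<close> and \<open>y\<close> as separate functions and with the filter \<open>D\<close> as a variable, so that it can be verified by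
  the rules for real derivatives alone.
\<close>

lemma first_integral:
  fixes H :: "real \<times> real \<Rightarrow> real"
  assumes arc: "arc_in F S {0..T} \<phi>"
    and H: "\<And>(x :: real \<Rightarrow> real) (y :: real \<Rightarrow> real) t D. (x has_real_derivative fst (F (x t, y t))) D \<Longrightarrow>
      (y has_real_derivative snd (F (x t, y t))) D \<Longrightarrow> D = at t within {0..T} \<Longrightarrow>
      ((\<lambda>t. H (x t, y t)) has_real_derivative 0) D"
    and st: "s \<in> {0..T}" "t \<in> {0..T}"
  shows "H (\<phi> s) = H (\<phi> t)"
proof -
  have "((\<lambda>t. H (\<phi> t)) has_real_derivative 0) (at r within {0..T})" if "r \<in> {0..T}" for r
  proof -
    have "(\<phi> has_vector_derivative F (\<phi> r)) (at r within {0..T})"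
      using arc that by (simp add: arc_in_def)
    then have "((\<lambda>r. fst (\<phi> r)) has_real_derivative fst (F (\<phi> r))) (at r within {0..T})"
      and "((\<lambda>r. snd (\<phi> r)) has_real_derivative snd (F (\<phi> r))) (at r within {0..T})"
      unfolding has_real_derivative_iff_has_vector_derivative
      by (auto intro: bounded_linear.has_vector_derivative[OF bounded_linear_fst]
          bounded_linear.has_vector_derivative[OF bounded_linear_snd])
    then show ?thesis
      using H[where x = "\<lambda>r. fst (\<phi> r)" and y = "\<lambda>r. snd (\<phi> r)" and t = r] by simp
  qed
  then obtain c where "\<And>r. r \<in> {0..T} \<Longrightarrow> H (\<phi> r) = c"
    using has_field_derivative_zero_constant[of "{0..T}" "\<lambda>t. H (\<phi> t)"] by auto
  then show ?thesis
    using st by simp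
qed

text \<open>
  Membership in the region is decided by the first integral of \<open>X\<close> above the line and by that of
  \<open>Y\<close> below it, so it cannot change along an arc, forward or backward.
\<close>

lemma invariant_region: "Z.invariant region"
proof (rule Z.invariantI)
  fix \<phi> :: "real \<Rightarrow> real \<times> real" and T s t
  assume "Z.some_arc {0..T} \<phi>" and st: "s \<in> {0..T}" "t \<in> {0..T}" and s: "\<phi> s \<in> region"
  then consider "arc_in field_up Z.upper {0..T} \<phi>" | "arc_in field_down Z.lower {0..T} \<phi>" | "Z.arc_Sigma {0..T} \<phi>"
    unfolding Z.some_arc_def Z.arc_X_def Z.arc_Y_def by blast
  then show "\<phi> t \<in> region"
  proof cases
    case 1
    have "snd (\<phi> s) + (fst (\<phi> s))\<^sup>2 = snd (\<phi> t) + (fst (\<phi> t))\<^sup>2"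
    proof (rule first_integral[OF 1 _ st])
      fix x y :: "real \<Rightarrow> real" and r and D
      assume "(x has_real_derivative fst (field_up (x r, y r))) D" "(y has_real_derivative snd (field_up (x r, y r))) D"
        and "D = at r within {0..T}"
      then show "((\<lambda>r. snd (x r, y r) + (fst (x r, y r))\<^sup>2) has_real_derivative 0) D"
        by (auto intro!: derivative_eq_intros)
    qed
    moreover have "snd (\<phi> s) \<ge> 0" "snd (\<phi> t) \<ge> 0"
      using 1 st unfolding arc_in_def by (metis prod.collapse upper_iff)+
    ultimately show ?thesis
      using s region_upper_iff[of "snd (\<phi> s)" "fst (\<phi> s)"] region_upper_iff[of "snd (\<phi> t)" "fst (\<phi> t)"] by simp
  next
    case 2
    have "snd (\<phi> s) - bowl 0 (fst (\<phi> s)) = snd (\<phi> t) - bowl 0 (fst (\<phi> t))"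
    proof (rule first_integral[OF 2 _ st])
      fix x y :: "real \<Rightarrow> real" and r and D
      assume "(x has_real_derivative fst (field_down (x r, y r))) D" "(y has_real_derivative snd (field_down (x r, y r))) D"
        and "D = at r within {0..T}"
      then show "((\<lambda>r. snd (x r, y r) - bowl 0 (fst (x r, y r))) has_real_derivative 0) D"
        unfolding bowl_def by (auto intro!: derivative_eq_intros) (simp add: algebra_simps)
    qed
    moreover have "snd (\<phi> s) \<le> 0" "snd (\<phi> t) \<le> 0"
      using 2 st unfolding arc_in_def by (metis prod.collapse lower_iff)+
    ultimately show ?thesis
      using s region_lower_iff[of "snd (\<phi> s)" "fst (\<phi> s)"] region_lower_iff[of "snd (\<phi> t)" "fst (\<phi> t)"] by simp
  next
    case 3
    then have "(fst (\<phi> t), snd (\<phi> t)) \<in> Z.sigma_domain"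
      using st unfolding Z.arc_Sigma_def arc_in_def by simp
    then have "snd (\<phi> t) = 0" "2 * (fst (\<phi> t))\<^sup>2 \<le> 1"
      unfolding sigma_domain_iff by auto
    then show ?thesis
      using region_upper_iff[of "snd (\<phi> t)" "fst (\<phi> t)"] by (cases "\<phi> t") simp
  qed
qed

theorem theorem8:
  fixes f :: "real \<times> real \<Rightarrow> real"
    and X Y :: "real \<times> real \<Rightarrow> real \<times> real"
    and \<Lambda> :: "(real \<times> real) set"
  assumes f: "f = (\<lambda>(x, y). y)"
    and X: "X = (\<lambda>(x, y). (1, - 2 * x))"
    and Y: "Y = (\<lambda>(x, y). (- 2, - 4 * x ^ 3 + 2 * x))"
    and \<Lambda>: "\<Lambda> = {(x, y). - 1 \<le> x \<and> x \<le> 1 \<and> x ^ 4 / 2 - x ^ 2 / 2 \<le> y \<and> y \<le> 1 - x ^ 2}"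
  shows "psvf.chaotic_on f X Y \<Lambda>"
proof -
  have mem: "(- 1, 0) \<in> region" "(1, 0) \<in> region"
    by (simp_all add: region_def)
  obtain \<Gamma> where "Z.positive_global_trajectory \<Gamma> (- 1, 0)"
    using periodic_trajectory by blast
  with compact_region invariant_region legs_in_region mem(1) have "Z.chaotic_on region"
    by (rule Z.chaotic_onI[OF _ _ _ _ _ mem]) simp_all
  then show ?thesis
    unfolding f X Y \<Lambda> height_def field_up_def field_down_def region_def .
qed

end
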